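(* Let $(t_k)$ be a sequence of positive reals decreasing to $0$, let $\mathcal{R}\in\{S,LF,KDB,SU,KS\}$, and let $(x^k)$ be a sequence such that, for every $k$, the point $x^k\in X$ is a global optimal solution of the relaxed problem $\min_{x\in X}\psi_{\mathcal{R}}^{t_k}(x)$. If $x^k\to\bar x$ as $k\to\infty$, then $\bar x$ is a global optimal solution of the problem $\min_{x\in X}\psi_p(x)$, provided that one of the following assumptions holds: (a) $\mathcal{R}\in\{S,LF,SU,KS\}$, the function $x\mapsto\psi_p(x)$ is lower semicontinuous at $\bar x$, and for every $x\in\mathbb{R}^n$ the function $t\mapsto\psi_{\mathcal{R}}^t(x)$ is upper semicontinuous at $0^+$. (b) $\mathcal{R}=KDB$ and, for every $x\in\mathbb{R}^n$, the function $(t,u)\mapsto\psi_{\mathcal{R}}^t(u)$ is lower semicontinuous at $(0^+,x)$ and the function $t\mapsto\psi_{\mathcal{R}}^t(x)$ is upper semicontinuous at $0^+$.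
   Context: Problem data. $F,f:\mathbb{R}^n\times\mathbb{R}^m\to\mathbb{R}$, $G:\mathbb{R}^n\to\mathbb{R}^p$, $g:\mathbb{R}^n\times\mathbb{R}^m\to\mathbb{R}^q$; $F,G$ are twice and $f,g$ thrice continuously differentiable. $X=\{x\in\mathbb{R}^n: G(x)\le 0\}$. For every $x\in X$: the lower-level problem $\min_y\{f(x,y): g(x,y)\le 0\}$ has at least one solution; $f(x,\cdot)$ and all $g_i(x,\cdot)$ are convex; there is $y(x)\in\mathbb{R}^m$ with $g_i(x,y(x))<0$ for all $i=1,\dots,q$. Put $\mathcal{L}(x,y,u)=\nabla_y f(x,y)+\sum_{i=1}^q u_i\nabla_y g_i(x,y)\in\mathbb{R}^m$, and $$\mathcal{D}(x)=\{(y,u)\in\mathbb{R}^{m+q}: \mathcal{L}(x,y,u)=0,\ u\ge 0,\ g(x,y)\le 0,\ u^\top g(x,y)=0\}.$$ Relaxations. For $t>0$ and $\mathcal{R}\in\{S,LF,KDB,SU,KS\}$ (Scholtes; Lin–Fukushima; Kadrani–Dussault–Benchakroun; Steffensen–Ulbrich; Kanzow–Schwartz), $\mathcal{D}^t_{\mathcal{R}}(x)$ is the set of $(y,u)\in\mathbb{R}^{m+q}$ with $\mathcal{L}(x,y,u)=0$ and, for all $i=1,\dots,q$ (writing $g_i=g_i(x,y)$): - $S$: $g_i\le 0$, $-u_i\le 0$, $-u_ig_i-t\le 0$; - $LF$: $-(u_ig_i+t^2)\le 0$, $-(u_i+t)(-g_i+t)+t^2\le 0$; - $KDB$: $g_i-t\le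 0$, $-u_i-t\le 0$, $-(u_i-t)(g_i+t)\le 0$; - $SU$: $g_i\le 0$, $-u_i\le 0$, $\varphi^t_{i,SU}(x,y,u)\le 0$; - $KS$: $g_i\le 0$, $-u_i\le 0$, $\varphi^t_{i,KS}(x,y,u)\le 0$. Here $\varphi^t_{i,SU}=2u_i$ if $g_i+u_i\le -t$; $\varphi^t_{i,SU}=-2g_i$ if $g_i+u_i\ge t$; $\varphi^t_{i,SU}=u_i-g_i-t\,\vartheta\big(\frac{u_i+g_i}{t}\big)$ if $|u_i+g_i|<t$, where $\vartheta:[-1,1]\to\mathbb{R}$ is a fixed regularization function: $\vartheta$ is $C^2$ on $[-1,1]$, $\vartheta(\pm1)=1$, $\vartheta'(-1)=-1$, $\vartheta'(1)=1$, $\vartheta''(\pm1)=0$, $\vartheta''>0$ on $(-1,1)$. And $\varphi^t_{i,KS}=(u_i-t)(-g_i-t)$ if $u_i-g_i\ge 2t$; $\varphi^t_{i,KS}=-\frac12\big((u_i-t)^2+(-g_i-t)^2\big)$ if $u_i-g_i<2t$. It is assumed throughout that $\mathcal{D}^t_{\mathcal{R}}(x)\neq\emptyset$ for all $t>0$, $x\in\mathbb{R}^n$ and all $\mathcal{R}$. Value functions: $\psi_p(x)=\max_{(y,u)\in\mathcal{D}(x)}F(x,y)$ and $\psi^t_{\mathcal{R}}(x)=\max_{(y,u)\in\mathcal{D}^t_{\mathcal{R}}(x)}F(x,y)$ (optimal values, i.e. suprema in the extended reals if not attained). Global optimal solution of $\min_{x\in X}\psi(x)$: a point $\bar x\in X$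 with $\psi(\bar x)\le\psi(x)$ for all $x\in X$. Semicontinuity at $0^+$ uses the convention $\psi^0_{\mathcal{R}}:=\psi_p$: $t\mapsto\psi^t_{\mathcal{R}}(x)$ is upper semicontinuous at $0^+$ if $\limsup_{t\downarrow 0}\psi^t_{\mathcal{R}}(x)\le\psi_p(x)$; $(t,u)\mapsto\psi^t_{\mathcal{R}}(u)$ is lower semicontinuous at $(0^+,x)$ if $\liminf_{t\downarrow 0,\,u\to x}\psi^t_{\mathcal{R}}(u)\ge\psi_p(x)$. *)

theory Defs
  imports "HOL-Analysis.Analysis"
begin

text \<open>Class \<open>C\<^sup>k\<close> on the whole space, via iterated directional derivatives along arbitrary
  directions; in finite dimension this is the usual notion.\<close>

primrec C_class :: "nat \<Rightarrow> ('a::real_normed_vector \<Rightarrow> 'b::real_normed_vector) \<Rightarrow> bool" where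
  "C_class 0 h \<longleftrightarrow> continuous_on UNIV h"
| "C_class (Suc k) h \<longleftrightarrow>
     (\<forall>z. h differentiable (at z)) \<and> (\<forall>v. C_class k (\<lambda>z. frechet_derivative h (at z) v))"

definition grad_y :: "('a \<times> 'b::real_inner \<Rightarrow> real) \<Rightarrow> 'a \<Rightarrow> 'b \<Rightarrow> 'b" where
  "grad_y h x y = (THE d. GDERIV (\<lambda>y'. h (x, y')) y :> d)"

definition global_solution :: "'a set \<Rightarrow> ('a \<Rightarrow> 'b::ord) \<Rightarrow> 'a \<Rightarrow> bool" where
  "global_solution X h x \<longleftrightarrow> x \<in> X \<and> (\<forall>x'\<in>X. h x \<le> h x')"

text \<open>On vectors, \<open>\<le>\<close> is the componentwise order.\<close>

definition upper_feasible :: "(real^'n \<Rightarrow> real^'p) \<Rightarrow> (real^'n) set" where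
  "upper_feasible G = {x. G x \<le> 0}"

definition lower_feasible :: "((real^'n) \<times> (real^'m) \<Rightarrow> real^'q) \<Rightarrow> real^'n \<Rightarrow> (real^'m) set" where
  "lower_feasible g x = {y. g (x, y) \<le> 0}"

definition lagrange_grad ::
  "((real^'n) \<times> (real^'m) \<Rightarrow> real) \<Rightarrow> ((real^'n) \<times> (real^'m) \<Rightarrow> real^'q) \<Rightarrow>
   real^'n \<Rightarrow> real^'m \<Rightarrow> real^'q \<Rightarrow> real^'m" where
  "lagrange_grad f g x y u =
     grad_y f x y + (\<Sum>i\<in>UNIV. (u $ i) *\<^sub>R grad_y (\<lambda>z. g z $ i) x y)"

definition kkt_set ::
  "((real^'n) \<times> (real^'m) \<Rightarrow> real) \<Rightarrow> ((real^'n) \<times> (real^'m) \<Rightarrow> real^'q) \<Rightarrow>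
   real^'n \<Rightarrow> ((real^'m) \<times> (real^'q)) set" where
  "kkt_set f g x =
     {(y, u). lagrange_grad f g x y u = 0 \<and> 0 \<le> u \<and> g (x, y) \<le> 0 \<and> u \<bullet> g (x, y) = 0}"

text \<open>The derivatives of \<open>\<theta>\<close> at \<open>-1\<close> and \<open>1\<close> are one-sided; values of \<open>\<theta>\<close> outside
  \<open>[-1,1]\<close> are irrelevant.\<close>

definition regularization_function :: "(real \<Rightarrow> real) \<Rightarrow> bool" where
  "regularization_function \<theta> \<longleftrightarrow>
     (\<exists>\<theta>1 \<theta>2.
        (\<forall>z\<in>{-1..1}. (\<theta> has_real_derivative \<theta>1 z) (at z within {-1..1})) \<and>
        (\<forall>z\<in>{-1..1}. (\<theta>1 has_real_derivative \<theta>2 z) (at z within {-1..1})) \<and>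
        continuous_on {-1..1} \<theta>2 \<and>
        \<theta> (-1) = 1 \<and> \<theta> 1 = 1 \<and> \<theta>1 (-1) = -1 \<and> \<theta>1 1 = 1 \<and>
        \<theta>2 (-1) = 0 \<and> \<theta>2 1 = 0 \<and> (\<forall>z\<in>{-1<..<1}. 0 < \<theta>2 z))"

datatype relaxation =
    Scholtes
  | Lin_Fukushima
  | Kadrani_Dussault_Benchakroun
  | Steffensen_Ulbrich
  | Kanzow_Schwartz

text \<open>In the following functions \<open>a\<close> stands for \<open>u\<^sub>i\<close> and \<open>b\<close> for \<open>g\<^sub>i(x,y)\<close>.\<close>

definition phi_SU :: "(real \<Rightarrow> real) \<Rightarrow> real \<Rightarrow> real \<Rightarrow> real \<Rightarrow> real" where
  "phi_SU \<theta> t a b =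
     (if b + a \<le> - t then 2 * a
      else if b + a \<ge> t then - 2 * b
      else a - b - t * \<theta> ((a + b) / t))"

definition phi_KS :: "real \<Rightarrow> real \<Rightarrow> real \<Rightarrow> real" where
  "phi_KS t a b =
     (if a - b \<ge> 2 * t then (a - t) * (- b - t)
      else - (1 / 2) * ((a - t)\<^sup>2 + (- b - t)\<^sup>2))"

fun relaxed_compl :: "(real \<Rightarrow> real) \<Rightarrow> relaxation \<Rightarrow> real \<Rightarrow> real \<Rightarrow> real \<Rightarrow> bool" where
  "relaxed_compl \<theta> Scholtes t a b \<longleftrightarrow> b \<le> 0 \<and> - a \<le> 0 \<and> - a * b - t \<le> 0"
| "relaxed_compl \<theta> Lin_Fukushima t a b \<longleftrightarrow>
     - (a * b + t\<^sup>2) \<le> 0 \<and> - ((a + t) * (- b + t)) + t\<^sup>2 \<le> 0"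
| "relaxed_compl \<theta> Kadrani_Dussault_Benchakroun t a b \<longleftrightarrow>
     b - t \<le> 0 \<and> - a - t \<le> 0 \<and> - ((a - t) * (b + t)) \<le> 0"
| "relaxed_compl \<theta> Steffensen_Ulbrich t a b \<longleftrightarrow> b \<le> 0 \<and> - a \<le> 0 \<and> phi_SU \<theta> t a b \<le> 0"
| "relaxed_compl \<theta> Kanzow_Schwartz t a b \<longleftrightarrow> b \<le> 0 \<and> - a \<le> 0 \<and> phi_KS t a b \<le> 0"

definition relaxed_set ::
  "((real^'n) \<times> (real^'m) \<Rightarrow> real) \<Rightarrow> ((real^'n) \<times> (real^'m) \<Rightarrow> real^'q) \<Rightarrow> (real \<Rightarrow> real) \<Rightarrow>
   relaxation \<Rightarrow> real \<Rightarrow> real^'n \<Rightarrow> ((real^'m) \<times> (real^'q)) set" where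
  "relaxed_set f g \<theta> R t x =
     {(y, u). lagrange_grad f g x y u = 0 \<and> (\<forall>i. relaxed_compl \<theta> R t (u $ i) (g (x, y) $ i))}"

text \<open>Value functions, as suprema in the extended reals (\<open>-\<infinity>\<close> over the empty set).\<close>

definition psi_p ::
  "((real^'n) \<times> (real^'m) \<Rightarrow> real) \<Rightarrow> ((real^'n) \<times> (real^'m) \<Rightarrow> real) \<Rightarrow>
   ((real^'n) \<times> (real^'m) \<Rightarrow> real^'q) \<Rightarrow> real^'n \<Rightarrow> ereal" where
  "psi_p F f g x = (SUP (y, u) \<in> kkt_set f g x. ereal (F (x, y)))"

definition psi_relaxed ::
  "((real^'n) \<times> (real^'m) \<Rightarrow> real) \<Rightarrow> ((real^'n) \<times> (real^'m) \<Rightarrow> real) \<Rightarrow>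
   ((real^'n) \<times> (real^'m) \<Rightarrow> real^'q) \<Rightarrow> (real \<Rightarrow> real) \<Rightarrow>
   relaxation \<Rightarrow> real \<Rightarrow> real^'n \<Rightarrow> ereal" where
  "psi_relaxed F f g \<theta> R t x = (SUP (y, u) \<in> relaxed_set f g \<theta> R t x. ereal (F (x, y)))"

definition lsc_at :: "('a::topological_space \<Rightarrow> ereal) \<Rightarrow> 'a \<Rightarrow> bool" where
  "lsc_at h x \<longleftrightarrow> h x \<le> Liminf (nhds x) h"

text \<open>For a family \<open>h t x\<close>, \<open>t > 0\<close>, the function \<open>h0\<close> supplies the value at \<open>t = 0\<close>.
  In the joint limit \<open>t\<close> stays positive, while \<open>x'\<close> may equal \<open>x\<close>.\<close>

definition usc_at_zero_right :: "(real \<Rightarrow> 'a \<Rightarrow> ereal) \<Rightarrow> ('a \<Rightarrow> ereal) \<Rightarrow> 'a \<Rightarrow> bool" where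
  "usc_at_zero_right h h0 x \<longleftrightarrow> Limsup (at_right 0) (\<lambda>t. h t x) \<le> h0 x"

definition lsc_at_zero_right ::
  "(real \<Rightarrow> 'a::topological_space \<Rightarrow> ereal) \<Rightarrow> ('a \<Rightarrow> ereal) \<Rightarrow> 'a \<Rightarrow> bool" where
  "lsc_at_zero_right h h0 x \<longleftrightarrow>
     h0 x \<le> Liminf (at_right 0 \<times>\<^sub>F nhds x) (\<lambda>(t, x'). h t x')"

end

theory Submission
  imports Defs
begin

text \<open>
  Global optimality survives a limit of minimisation problems as soon as two one-sided estimates
  hold (\<open>global_solution_of_limit_problem\<close>): the optimal values asymptotically dominate the limit
  value at \<open>xbar\<close>, and at every fixed competitor the approximating values asymptotically do not
  exceed the limit value. With both, for every \<open>x \<in> X\<close>,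
  \<open>\<psi>\<^sub>p xbar \<le> liminf \<psi>\<^bsup>t k\<^esup> (xs k) \<le> limsup \<psi>\<^bsup>t k\<^esup> x \<le> \<psi>\<^sub>p x\<close>,
  where the middle step is the optimality of \<open>xs k\<close>.

  The last estimate is upper semicontinuity at \<open>0\<^sup>+\<close>, restricted to the sequence \<open>t\<close>. For the
  Kadrani-Dussault-Benchakroun relaxation the first one is joint lower semicontinuity, restricted
  to the sequence \<open>(t k, xs k)\<close>. For the other four relaxations, lower semicontinuity of the
  limit function \<open>\<psi>\<^sub>p\<close> alone suffices, because these relaxations really enlarge the feasible set
  (\<open>kkt_set_subset_relaxed_set\<close>), so that \<open>\<psi>\<^sub>p (xs k) \<le> \<psi>\<^bsup>t k\<^esup> (xs k)\<close>. The inclusion fails for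
  Kadrani-Dussault-Benchakroun, whose condition \<open>(u\<^sub>i - t) * (g\<^sub>i + t) \<ge> 0\<close> cuts off the
  complementary pair \<open>u\<^sub>i = g\<^sub>i = 0\<close>.

  That complementary pairs are relaxed-feasible is elementary except for Steffensen-Ulbrich,
  where it amounts to \<open>\<bar>z\<bar> \<le> \<theta> z\<close> on \<open>[-1, 1]\<close>: a convex function lies above its tangents at
  the two end points, and for \<open>\<theta>\<close> these are \<open>-z\<close> and \<open>z\<close>
  (\<open>regularization_function_ge_abs\<close>).
\<close>

section \<open>The regularization function lies above the absolute value\<close>

lemma increasing_if_derivative_nonneg_within:
  fixes h h' :: "real \<Rightarrow> real"
  assumes deriv: "\<And>z. z \<in> {a..b} \<Longrightarrow> (h has_real_derivative h' z) (at z within {a..b})"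
    and nonneg: "\<And>z. z \<in> {a<..<b} \<Longrightarrow> 0 \<le> h' z"
    and "a \<le> x" "x \<le> y" "y \<le> b"
  shows "h x \<le> h y"
proof (rule DERIV_nonneg_imp_increasing_open[OF \<open>x \<le> y\<close>])
  fix z assume z: "x < z" "z < y"
  then have "z \<in> {a<..<b}"
    using assms by auto
  moreover have "(h has_real_derivative h' z) (at z)"
    using deriv[of z] \<open>z \<in> {a<..<b}\<close> at_within_Icc_at[of a z b] by auto
  ultimately show "\<exists>d. (h has_real_derivative d) (at z) \<and> 0 \<le> d"
    using nonneg by blast
next
  have "continuous_on {a..b} h"
    using deriv by (rule DERIV_continuous_on)
  then show "continuous_on {x..y} h"
    by (rule continuous_on_subset) (use assms in auto)
qed

text \<open>The end point tangents \<open>z \<mapsto> -z\<close> and \<open>z \<mapsto> z\<close> of the convex function \<open>\<theta>\<close> support it from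
  below. Concretely, \<open>\<theta>''\<close> being nonnegative confines \<open>\<theta>'\<close> to \<open>[-1, 1]\<close>, so \<open>\<theta> z + z\<close> increases
  from \<open>0\<close> and \<open>\<theta> z - z\<close> decreases to \<open>0\<close>.\<close>

lemma regularization_function_ge_abs:
  assumes "regularization_function \<theta>" and "\<bar>z\<bar> \<le> 1"
  shows "\<bar>z\<bar> \<le> \<theta> z"
proof -
  obtain \<theta>1 \<theta>2 where
    d1: "\<And>z. z \<in> {-1..1} \<Longrightarrow> (\<theta> has_real_derivative \<theta>1 z) (at z within {-1..1})" and
    d2: "\<And>z. z \<in> {-1..1} \<Longrightarrow> (\<theta>1 has_real_derivative \<theta>2 z) (at z within {-1..1})" and
    ends: "\<theta> (-1) = 1" "\<theta> 1 = 1" "\<theta>1 (-1) = -1" "\<theta>1 1 = 1" and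
    pos: "\<And>z. z \<in> {-1<..<1} \<Longrightarrow> 0 < \<theta>2 z"
    using assms(1) unfolding regularization_function_def by blast
  have mono: "\<theta>1 x \<le> \<theta>1 y" if "-1 \<le> x" "x \<le> y" "y \<le> 1" for x y
    by (rule increasing_if_derivative_nonneg_within[OF d2]) (use pos that in \<open>auto intro: less_imp_le\<close>)
  have slope: "-1 \<le> \<theta>1 w" "\<theta>1 w \<le> 1" if "w \<in> {-1<..<1}" for w
    using mono[of "-1" w] mono[of w 1] that ends by auto
  have "\<theta> (-1) + (-1) \<le> \<theta> z + z"
    by (rule increasing_if_derivative_nonneg_within[where a = "-1" and b = 1 and h' = "\<lambda>z. \<theta>1 z + 1"
          and h = "\<lambda>z. \<theta> z + z"])
      (use slope assms(2) in \<open>force intro!: DERIV_add d1 DERIV_ident\<close>)+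
  moreover have "z - \<theta> z \<le> 1 - \<theta> 1"
    by (rule increasing_if_derivative_nonneg_within[where a = "-1" and b = 1 and h' = "\<lambda>z. 1 - \<theta>1 z"
          and h = "\<lambda>z. z - \<theta> z"])
      (use slope assms(2) in \<open>force intro!: DERIV_diff d1 DERIV_ident\<close>)+
  ultimately show ?thesis
    using ends by linarith
qed

section \<open>Relaxations that contain the complementarity set\<close>

text \<open>On the boundary rays \<open>a = 0 \<ge> b\<close> and \<open>b = 0 \<le> a\<close>, both outer branches of the
  Steffensen-Ulbrich function vanish, and on the middle branch
  \<open>a - b = \<bar>a + b\<bar> \<le> t * \<theta> ((a + b) / t)\<close>.\<close>

lemma phi_SU_nonpos_if_complementary:
  assumes "regularization_function \<theta>" and "0 < t" and ab: "0 \<le> a" "b \<le> 0" "a * b = 0"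
  shows "phi_SU \<theta> t a b \<le> 0"
proof (cases "\<bar>a + b\<bar> < t")
  case True
  then have "\<bar>(a + b) / t\<bar> \<le> 1"
    using \<open>0 < t\<close> by (simp add: abs_divide)
  then have "\<bar>(a + b) / t\<bar> \<le> \<theta> ((a + b) / t)"
    by (rule regularization_function_ge_abs[OF assms(1)])
  then have "\<bar>a + b\<bar> \<le> t * \<theta> ((a + b) / t)"
    using \<open>0 < t\<close> by (simp add: abs_divide pos_divide_le_eq mult.commute)
  moreover have "a - b = \<bar>a + b\<bar>"
    using ab by auto
  ultimately show ?thesis
    using True by (auto simp: phi_SU_def)
next
  case False
  then show ?thesis
    using ab \<open>0 < t\<close> by (auto simp: phi_SU_def)
qed

lemma phi_KS_nonpos_if_complementary:
  assumes "0 < t" and "0 \<le> a" "b \<le> 0" "a * b = 0"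
  shows "phi_KS t a b \<le> 0"
  using assms by (auto simp: phi_KS_def mult_le_0_iff zero_le_mult_iff)

lemma relaxed_compl_if_complementary:
  assumes "regularization_function \<theta>" and "0 < t" and "0 \<le> a" "b \<le> 0" "a * b = 0"
    and "R \<noteq> Kadrani_Dussault_Benchakroun"
  shows "relaxed_compl \<theta> R t a b"
proof (cases R)
  case Lin_Fukushima
  have "t * b \<le> t * a"
    using assms by (intro mult_left_mono) auto
  then show ?thesis
    using Lin_Fukushima \<open>a * b = 0\<close> by (auto simp: algebra_simps power2_eq_square)
qed (use assms phi_SU_nonpos_if_complementary phi_KS_nonpos_if_complementary in auto)

text \<open>All terms of \<open>u \<bullet> g\<close> have the same sign, so the scalar complementarity condition
  decouples into complementarity of every pair \<open>(u\<^sub>i, g\<^sub>i)\<close>.\<close>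

lemma complementary_components:
  fixes u v :: "real^'q"
  assumes "0 \<le> u" "v \<le> 0" "u \<bullet> v = 0"
  shows "u $ i * v $ i = 0"
proof -
  have "(\<Sum>i\<in>UNIV. - (u $ i * v $ i)) = 0"
    using assms(3) by (simp add: inner_vec_def sum_negf)
  moreover have "0 \<le> - (u $ i * v $ i)" for i
    using assms(1,2) by (simp add: less_eq_vec_def mult_nonneg_nonpos)
  ultimately show ?thesis
    by (simp add: sum_nonneg_eq_0_iff)
qed

lemma kkt_set_subset_relaxed_set:
  assumes "regularization_function \<theta>" and "0 < t" and "R \<noteq> Kadrani_Dussault_Benchakroun"
  shows "kkt_set f g x \<subseteq> relaxed_set f g \<theta> R t x"
proof (clarsimp simp: kkt_set_def relaxed_set_def)
  fix y u i
  assume u: "0 \<le> u" "g (x, y) \<le> 0" "u \<bullet> g (x, y) = 0"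
  show "relaxed_compl \<theta> R t (u $ i) (g (x, y) $ i)"
    using u complementary_components[OF u]
    by (intro relaxed_compl_if_complementary assms) (auto simp: less_eq_vec_def)
qed

lemma psi_p_le_psi_relaxed:
  assumes "regularization_function \<theta>" and "0 < t" and "R \<noteq> Kadrani_Dussault_Benchakroun"
  shows "psi_p F f g x \<le> psi_relaxed F f g \<theta> R t x"
  unfolding psi_p_def psi_relaxed_def
  by (rule SUP_subset_mono[OF kkt_set_subset_relaxed_set[OF assms] order_refl])

section \<open>Passing to the limit in global optimality\<close>

lemma Liminf_le_liminf_compose:
  fixes h :: "'a \<Rightarrow> ereal"
  assumes "filterlim s A sequentially"
  shows "Liminf A h \<le> liminf (\<lambda>k. h (s k))"
proof -
  have "Liminf A h \<le> Liminf (filtermap s sequentially) h"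
    using assms unfolding filterlim_def Liminf_def
    by (intro SUP_subset_mono) (auto dest: filter_leD)
  also have "\<dots> \<le> liminf (\<lambda>k. h (s k))"
    by (rule Liminf_filtermap_le)
  finally show ?thesis .
qed

lemma limsup_compose_le_Limsup:
  fixes h :: "'a \<Rightarrow> ereal"
  assumes "filterlim s A sequentially"
  shows "limsup (\<lambda>k. h (s k)) \<le> Limsup A h"
proof -
  have "limsup (\<lambda>k. h (s k)) \<le> Limsup (filtermap s sequentially) h"
    by (rule Limsup_filtermap_ge)
  also have "\<dots> \<le> Limsup A h"
    using assms unfolding filterlim_def Limsup_def
    by (intro INF_superset_mono) (auto dest: filter_leD)
  finally show ?thesis .
qed

text \<open>Optimality compares \<open>h k (xs k)\<close>, where the point moves, with \<open>h k x\<close>, where it stays fixed.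
  Hence the lower estimate is posed along the minimisers and the upper one pointwise.\<close>

lemma global_solution_of_limit_problem:
  fixes h :: "nat \<Rightarrow> 'a \<Rightarrow> ereal"
  assumes "xbar \<in> X"
    and opt: "\<And>k. global_solution X (h k) (xs k)"
    and lower: "h0 xbar \<le> liminf (\<lambda>k. h k (xs k))"
    and upper: "\<And>x. x \<in> X \<Longrightarrow> limsup (\<lambda>k. h k x) \<le> h0 x"
  shows "global_solution X h0 xbar"
  unfolding global_solution_def
proof (intro conjI ballI)
  fix x assume x: "x \<in> X"
  have "h0 xbar \<le> liminf (\<lambda>k. h k (xs k))"
    by (rule lower)
  also have "\<dots> \<le> liminf (\<lambda>k. h k x)"
    using opt x by (intro Liminf_mono always_eventually) (auto simp: global_solution_def)
  also have "\<dots> \<le> limsup (\<lambda>k. h k x)"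
    by (rule Liminf_le_Limsup) simp
  also have "\<dots> \<le> h0 x"
    by (rule upper[OF x])
  finally show "h0 xbar \<le> h0 x" .
qed (rule \<open>xbar \<in> X\<close>)

lemma closed_upper_feasible:
  assumes "C_class (Suc k) G"
  shows "closed (upper_feasible G)"
proof -
  have "continuous_on UNIV G"
    using assms by (auto intro!: continuous_at_imp_continuous_on differentiable_imp_continuous_within)
  then have "closed {x. \<forall>i. G x $ i \<le> 0}"
    by (intro closed_Collect_all closed_Collect_le continuous_intros)
  then show ?thesis
    by (simp add: upper_feasible_def less_eq_vec_def)
qed

theorem theorem4p1:
  fixes F f :: "(real^'n) \<times> (real^'m) \<Rightarrow> real"
    and G :: "real^'n \<Rightarrow> real^'p"
    and g :: "(real^'n) \<times> (real^'m) \<Rightarrow> real^'q"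
    and \<theta> :: "real \<Rightarrow> real"
    and R :: relaxation
    and t :: "nat \<Rightarrow> real"
    and xs :: "nat \<Rightarrow> real^'n"
    and xbar :: "real^'n"
  assumes "C_class 2 F" and "C_class 2 G" and "C_class 3 f" and "C_class 3 g"
    and lower_solvable: "\<And>x. x \<in> upper_feasible G \<Longrightarrow>
          \<exists>y. global_solution (lower_feasible g x) (\<lambda>y. f (x, y)) y"
    and f_convex: "\<And>x. x \<in> upper_feasible G \<Longrightarrow> convex_on UNIV (\<lambda>y. f (x, y))"
    and g_convex: "\<And>x i. x \<in> upper_feasible G \<Longrightarrow> convex_on UNIV (\<lambda>y. g (x, y) $ i)"
    and slater: "\<And>x. x \<in> upper_feasible G \<Longrightarrow> \<exists>y. \<forall>i. g (x, y) $ i < 0"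
    and "regularization_function \<theta>"
    and relaxed_nonempty: "\<And>R' s x. s > 0 \<Longrightarrow> relaxed_set f g \<theta> R' s x \<noteq> {}"
    and "\<And>k. t k > 0" and "decseq t" and "t \<longlonglongrightarrow> 0"
    and "\<And>k. global_solution (upper_feasible G) (psi_relaxed F f g \<theta> R (t k)) (xs k)"
    and "xs \<longlonglongrightarrow> xbar"
    and semicontinuity:
      "(R \<in> {Scholtes, Lin_Fukushima, Steffensen_Ulbrich, Kanzow_Schwartz} \<and>
        lsc_at (psi_p F f g) xbar \<and>
        (\<forall>x. usc_at_zero_right (psi_relaxed F f g \<theta> R) (psi_p F f g) x)) \<or>
       (R = Kadrani_Dussault_Benchakroun \<and>
        (\<forall>x. lsc_at_zero_right (psi_relaxed F f g \<theta> R) (psi_p F f g) x \<and>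
             usc_at_zero_right (psi_relaxed F f g \<theta> R) (psi_p F f g) x))"
  shows "global_solution (upper_feasible G) (psi_p F f g) xbar"
proof (rule global_solution_of_limit_problem[where h = "\<lambda>k. psi_relaxed F f g \<theta> R (t k)"
      and xs = xs])
  have t_lim: "filterlim t (at_right 0) sequentially"
    using \<open>\<And>k. t k > 0\<close> \<open>t \<longlonglongrightarrow> 0\<close> by (auto simp: filterlim_at intro!: always_eventually less_imp_neq[symmetric])
  show "global_solution (upper_feasible G) (psi_relaxed F f g \<theta> R (t k)) (xs k)" for k
    by fact
  have "closed (upper_feasible G)"
    using \<open>C_class 2 G\<close> by (intro closed_upper_feasible[of 1]) (simp add: numeral_2_eq_2)
  then show "xbar \<in> upper_feasible G"
    using \<open>\<And>k. global_solution (upper_feasible G) (psi_relaxed F f g \<theta> R (t k)) (xs k)\<close>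
      \<open>xs \<longlonglongrightarrow> xbar\<close>
    by (auto simp: closed_sequential_limits global_solution_def)
  show "limsup (\<lambda>k. psi_relaxed F f g \<theta> R (t k) x) \<le> psi_p F f g x" for x
    using semicontinuity
      limsup_compose_le_Limsup[OF t_lim, of "\<lambda>s. psi_relaxed F f g \<theta> R s x"]
    by (auto simp: usc_at_zero_right_def intro: order_trans)
  show "psi_p F f g xbar \<le> liminf (\<lambda>k. psi_relaxed F f g \<theta> R (t k) (xs k))"
  proof (cases "R = Kadrani_Dussault_Benchakroun")
    case True
    have "filterlim (\<lambda>k. (t k, xs k)) (at_right 0 \<times>\<^sub>F nhds xbar) sequentially"
      by (rule filterlim_Pair[OF t_lim \<open>xs \<longlonglongrightarrow> xbar\<close>])
    from Liminf_le_liminf_compose[OF this, of "\<lambda>(s, x). psi_relaxed F f g \<theta> R s x"]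
    show ?thesis
      using semicontinuity True by (auto simp: lsc_at_zero_right_def intro: order_trans)
  next
    case False
    then have "psi_p F f g xbar \<le> Liminf (nhds xbar) (psi_p F f g)"
      using semicontinuity by (auto simp: lsc_at_def)
    also have "\<dots> \<le> liminf (\<lambda>k. psi_p F f g (xs k))"
      by (rule Liminf_le_liminf_compose[OF \<open>xs \<longlonglongrightarrow> xbar\<close>])
    also have "\<dots> \<le> liminf (\<lambda>k. psi_relaxed F f g \<theta> R (t k) (xs k))"
      by (intro Liminf_mono always_eventually allI psi_p_le_psi_relaxed False) fact+
    finally show ?thesis .
  qed
qed

end
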